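(* Let $p,q$ be positive integers with $p\le q$ and $n=p+q$. For every $G\in\mathscr{U}_n^{p,q}$, $$\operatorname{per} L(G)\ge 20(p-1)(q-1)+4n,$$ with equality if and only if $G\cong B(p,q)$.
   Context: For a simple graph $G$, $L(G)=D(G)-A(G)$ is its Laplacian matrix ($D(G)$ the diagonal degree matrix, $A(G)$ the adjacency matrix), and $\operatorname{per} X=\sum_{\sigma\in S_n}\prod_{t=1}^n x_{t\sigma(t)}$ is the permanent. A unicyclic graph is a connected graph with the same number of vertices and edges. A connected graph has a $(p,q)$-bipartition if its vertex set splits into parts of sizes $p$ and $q$ with every edge joining the two parts; $\mathscr{U}_n^{p,q}$ is the set of bipartite unicyclic graphs on $n=p+q$ vertices with a $(p,q)$-bipartition ($p\le q$). $B(p,q)$ is the graph obtained from the 4-cycle $v_1v_2v_3v_4v_1$ by attaching $p-2$ pendant vertices at $v_1$ and $q-2$ pendant vertices at $v_2$. *)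

theory Defs
  imports "HOL-Combinatorics.Permutations"
begin

definition simple_graph :: "'a set \<Rightarrow> 'a set set \<Rightarrow> bool" where
  "simple_graph V E \<longleftrightarrow> finite V \<and> (\<forall>e\<in>E. \<exists>u v. e = {u, v} \<and> u \<noteq> v \<and> u \<in> V \<and> v \<in> V)"

definition adjacent :: "'a set set \<Rightarrow> 'a \<Rightarrow> 'a \<Rightarrow> bool" where
  "adjacent E u v \<longleftrightarrow> {u, v} \<in> E"

definition degree :: "'a set set \<Rightarrow> 'a \<Rightarrow> nat" where
  "degree E v = card {e \<in> E. v \<in> e}"

definition connected_graph :: "'a set \<Rightarrow> 'a set set \<Rightarrow> bool" where
  "connected_graph V E \<longleftrightarrow> V \<noteq> {} \<and> (\<forall>u\<in>V. \<forall>v\<in>V. (adjacent E)\<^sup>*\<^sup>* u v)"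

definition unicyclic :: "'a set \<Rightarrow> 'a set set \<Rightarrow> bool" where
  "unicyclic V E \<longleftrightarrow> simple_graph V E \<and> connected_graph V E \<and> card E = card V"

definition has_bipartition :: "'a set \<Rightarrow> 'a set set \<Rightarrow> nat \<Rightarrow> nat \<Rightarrow> bool" where
  "has_bipartition V E p q \<longleftrightarrow> (\<exists>X Y. X \<union> Y = V \<and> X \<inter> Y = {} \<and> card X = p \<and> card Y = q \<and>
      (\<forall>e\<in>E. \<exists>x\<in>X. \<exists>y\<in>Y. e = {x, y}))"

definition laplacian :: "'a set set \<Rightarrow> 'a \<Rightarrow> 'a \<Rightarrow> int" where
  "laplacian E u v = (if u = v then int (degree E u) else if {u, v} \<in> E then -1 else 0)"

definition per :: "('a \<Rightarrow> 'a \<Rightarrow> int) \<Rightarrow> 'a set \<Rightarrow> int" where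
  "per M I = (\<Sum>\<sigma>\<in>{\<sigma>. \<sigma> permutes I}. \<Prod>t\<in>I. M t (\<sigma> t))"

definition graph_iso :: "'a set \<Rightarrow> 'a set set \<Rightarrow> 'b set \<Rightarrow> 'b set set \<Rightarrow> bool" where
  "graph_iso V E V' E' \<longleftrightarrow> (\<exists>f. bij_betw f V V' \<and>
      (\<forall>u\<in>V. \<forall>v\<in>V. {u, v} \<in> E \<longleftrightarrow> {f u, f v} \<in> E'))"

text \<open>B(p,q): 4-cycle v1 v2 v3 v4 = 0 1 2 3, with p-2 pendants (4..p+1) at v1 = 0
  and q-2 pendants (p+2..p+q-1) at v2 = 1.\<close>
definition B_verts :: "nat \<Rightarrow> nat \<Rightarrow> nat set" where
  "B_verts p q = {0..<p+q}"

definition B_edges :: "nat \<Rightarrow> nat \<Rightarrow> nat set set" where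
  "B_edges p q = {{0,1},{1,2},{2,3},{3,0}} \<union> {{0,k} | k. 4 \<le> k \<and> k < p + 2}
      \<union> {{1,k} | k. p + 2 \<le> k \<and> k < p + q}"

end

theory Submission
  imports Defs
begin

text \<open>
  For a bipartite graph the signless Laplacian \<open>Q\<close> has the same permanent, and the same principal
  subpermanents, as the Laplacian, and all its entries are nonnegative. If \<open>l\<close> is a leaf attached
  to \<open>u\<close>, expansion along \<open>l\<close> gives \<open>per Q(G) = per Q(G - l) + 2 per Q(G - l)(u)\<close>, where \<open>(u)\<close>
  means deletion of the row and column of \<open>u\<close> without changing degrees. Removing leaves one by one,
  three lower bounds carry each other: \<open>20(p-1)(q-1) + 4(p+q)\<close> for the permanent, \<open>10(p-1) + 2\<close> after
  deletion of a vertex of the part of size \<open>p\<close>, and \<open>5\<close> after deletion of a vertex from each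
  part. The process stops at a 2-regular graph, which is the 4-cycle or so large that the identity
  and the transpositions of edges suffice. In case of equality every leaf must be
  attached where the second bound is attained, and these are the centres of \<open>B(p, q)\<close>.
\<close>

subsection \<open>Permanents\<close>

lemma permutes_remove_iff: "\<sigma> permutes (S - {u}) \<longleftrightarrow> \<sigma> permutes S \<and> \<sigma> u = u"
  unfolding permutes_def by auto

text \<open>Every permutation of \<open>insert a S\<close> is uniquely
  \<open>transpose a b \<circ> q\<close> with \<open>q\<close> permuting \<open>S\<close>, and
  \<open>b\<close> is then the image of \<open>a\<close>: this is expansion along row
  \<open>a\<close>.\<close>

lemma per_row_split:
  assumes "finite S" "a \<notin> S"
  shows "per M (insert a S) = M a a * per M S
    + (\<Sum>b\<in>S. M a b * (\<Sum>q | q permutes S. \<Prod>t\<in>S. M t (transpose a b (q t))))"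
proof -
  have qa: "q a = a" if "q permutes S" for q
    using that assms(2) by (simp add: permutes_def)
  have diag: "(\<Sum>q | q permutes S. \<Prod>t\<in>insert a S. M t ((transpose a a \<circ> q) t)) = M a a * per M S"
    unfolding per_def sum_distrib_left
    by (rule sum.cong) (use assms in \<open>auto simp: qa\<close>)
  have off: "(\<Sum>q | q permutes S. \<Prod>t\<in>insert a S. M t ((transpose a b \<circ> q) t))
      = M a b * (\<Sum>q | q permutes S. \<Prod>t\<in>S. M t (transpose a b (q t)))" for b
    unfolding sum_distrib_left
    by (rule sum.cong) (use assms in \<open>auto simp: qa\<close>)
  have "per M (insert a S)
      = (\<Sum>b\<in>insert a S. \<Sum>q | q permutes S. \<Prod>t\<in>insert a S. M t ((transpose a b \<circ> q) t))"
    unfolding per_def by (rule sum_over_permutations_insert[OF assms])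
  also have "\<dots> = M a a * per M S
    + (\<Sum>b\<in>S. M a b * (\<Sum>q | q permutes S. \<Prod>t\<in>S. M t (transpose a b (q t))))"
    by (simp only: sum.insert[OF assms] diag) (simp only: off)
  finally show ?thesis .
qed

lemma per_insert_isolated:
  assumes "finite S" "a \<notin> S" "\<And>t. t \<in> S \<Longrightarrow> M a t = 0"
  shows "per M (insert a S) = M a a * per M S"
  using assms by (simp add: per_row_split)

text \<open>In the expansion along row \<open>a\<close> only \<open>a\<close> and \<open>u\<close>
  are possible images of \<open>a\<close>; column \<open>a\<close> then forces the second case to
  contain the 2-cycle of \<open>a\<close> and \<open>u\<close>.\<close>

lemma per_insert_pendant:
  assumes S: "finite S" "a \<notin> S" "u \<in> S"
    and row: "\<And>t. t \<in> S \<Longrightarrow> t \<noteq> u \<Longrightarrow> M a t = 0"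
    and col: "\<And>t. t \<in> S \<Longrightarrow> t \<noteq> u \<Longrightarrow> M t a = 0"
  shows "per M (insert a S) = M a a * per M S + M a u * M u a * per M (S - {u})"
proof -
  have "(\<Sum>q | q permutes S. \<Prod>t\<in>S. M t (transpose a u (q t)))
      = (\<Sum>q | q permutes (S - {u}). \<Prod>t\<in>S. M t (transpose a u (q t)))"
  proof (rule sum.mono_neutral_right)
    show "finite {q. q permutes S}" using S by (simp add: finite_permutations)
    show "{q. q permutes (S - {u})} \<subseteq> {q. q permutes S}" by (auto simp: permutes_remove_iff)
    \<comment> \<open>If \<open>q\<close> moves \<open>u\<close>, the point \<open>t\<close> with
      \<open>q t = u\<close> is redirected to \<open>a\<close>, and
      \<open>M t a = 0\<close>.\<close>
    show "\<forall>q\<in>{q. q permutes S} - {q. q permutes (S - {u})}. (\<Prod>t\<in>S. M t (transpose a u (q t))) = 0"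
    proof
      fix q assume "q \<in> {q. q permutes S} - {q. q permutes (S - {u})}"
      then have q: "q permutes S" "q u \<noteq> u" by (auto simp: permutes_remove_iff)
      obtain t where t: "t \<in> S" "q t = u" using q(1) S(3) by (metis imageE permutes_image)
      with q(2) have "t \<noteq> u" by auto
      with t col show "(\<Prod>t\<in>S. M t (transpose a u (q t))) = 0"
        by (intro prod_zero[OF S(1)]) (auto intro!: bexI[of _ t])
    qed
  qed
  also have "\<dots> = (\<Sum>q | q permutes (S - {u}). M u a * (\<Prod>t\<in>S - {u}. M t (q t)))"
  proof (rule sum.cong[OF refl])
    fix q assume "q \<in> {q. q permutes (S - {u})}"
    then have q: "q permutes (S - {u})" by simp
    then have "q u = u" by (simp add: permutes_remove_iff)
    have "transpose a u (q t) = q t" if "t \<in> S - {u}" for t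
      using permutes_in_image[OF q, of t] that S(2) by (auto simp: transpose_def)
    with \<open>q u = u\<close> show "(\<Prod>t\<in>S. M t (transpose a u (q t))) = M u a * (\<Prod>t\<in>S - {u}. M t (q t))"
      using S by (simp add: prod.remove[of S u])
  qed
  also have "\<dots> = M u a * per M (S - {u})" by (simp add: per_def sum_distrib_left)
  finally have key: "(\<Sum>q | q permutes S. \<Prod>t\<in>S. M t (transpose a u (q t))) = M u a * per M (S - {u})" .
  have "(\<Sum>b\<in>S. M a b * (\<Sum>q | q permutes S. \<Prod>t\<in>S. M t (transpose a b (q t))))
      = M a u * (\<Sum>q | q permutes S. \<Prod>t\<in>S. M t (transpose a u (q t)))"
    using S row by (subst sum.remove[of S u]) (auto intro!: sum.neutral)
  then show ?thesis
    using S by (simp add: per_row_split key)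
qed

lemma per_diag_split:
  assumes "finite S" "u \<in> S"
  shows "per M S = M u u * per M (S - {u}) + (\<Sum>\<sigma> | \<sigma> permutes S \<and> \<sigma> u \<noteq> u. \<Prod>t\<in>S. M t (\<sigma> t))"
proof -
  have un: "{\<sigma>. \<sigma> permutes S} = {\<sigma>. \<sigma> permutes (S - {u})} \<union> {\<sigma>. \<sigma> permutes S \<and> \<sigma> u \<noteq> u}"
    by (auto simp: permutes_remove_iff)
  have fin: "finite {\<sigma>. \<sigma> permutes S}" using assms by (simp add: finite_permutations)
  have "per M S = (\<Sum>\<sigma> | \<sigma> permutes (S - {u}). \<Prod>t\<in>S. M t (\<sigma> t))
      + (\<Sum>\<sigma> | \<sigma> permutes S \<and> \<sigma> u \<noteq> u. \<Prod>t\<in>S. M t (\<sigma> t))"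
    unfolding per_def
    by (subst un, rule sum.union_disjoint) (auto simp: permutes_remove_iff intro: finite_subset[OF _ fin])
  also have "(\<Sum>\<sigma> | \<sigma> permutes (S - {u}). \<Prod>t\<in>S. M t (\<sigma> t)) = M u u * per M (S - {u})"
    unfolding per_def sum_distrib_left
    by (rule sum.cong) (use assms in \<open>auto simp: prod.remove[of S u] permutes_remove_iff\<close>)
  finally show ?thesis .
qed

lemma per_cong:
  assumes "\<And>s t. s \<in> S \<Longrightarrow> t \<in> S \<Longrightarrow> M s t = N s t"
  shows "per M S = per N S"
  unfolding per_def using assms by (auto intro!: sum.cong prod.cong simp: permutes_in_image)

text \<open>The permanent is affine in the entry \<open>M u u\<close>, with the permanent on
  \<open>S - {u}\<close> as slope, since permutations moving \<open>u\<close> do not use that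
  entry.\<close>

lemma per_diag_increment:
  assumes S: "finite S" "u \<in> S" and diag: "M u u = N u u + c"
    and eq: "\<And>s t. s \<in> S \<Longrightarrow> t \<in> S \<Longrightarrow> s \<noteq> u \<or> t \<noteq> u \<Longrightarrow> M s t = N s t"
  shows "per M S = per N S + c * per N (S - {u})"
proof -
  have "per M (S - {u}) = per N (S - {u})" by (rule per_cong) (use eq in auto)
  moreover have "(\<Sum>\<sigma> | \<sigma> permutes S \<and> \<sigma> u \<noteq> u. \<Prod>t\<in>S. M t (\<sigma> t))
      = (\<Sum>\<sigma> | \<sigma> permutes S \<and> \<sigma> u \<noteq> u. \<Prod>t\<in>S. N t (\<sigma> t))"
    by (intro sum.cong prod.cong) (use eq in \<open>auto simp: permutes_in_image\<close>)
  ultimately show ?thesis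
    using per_diag_split[OF S, of M] per_diag_split[OF S, of N] diag by (simp add: algebra_simps)
qed

lemma per_nonneg:
  assumes "\<And>s t. 0 \<le> M s t"
  shows "0 \<le> per M S"
  unfolding per_def by (intro sum_nonneg prod_nonneg) (use assms in auto)

text \<open>Nonnegativity allows all permutations to be dropped except the identity and the
  transpositions of the pairs in \<open>P\<close>. Disjointness of \<open>X\<close> and
  \<open>Y\<close> fixes the orientation of each pair, so distinct pairs give distinct
  transpositions, none of them the identity.\<close>

lemma per_ge_transpositions:
  assumes S: "finite S" and nonneg: "\<And>s t. 0 \<le> M s t"
    and XY: "X \<inter> Y = {}" and P: "P \<subseteq> (X \<inter> S) \<times> (Y \<inter> S)"
  shows "per M S \<ge> (\<Prod>t\<in>S. M t t) + (\<Sum>(x, y)\<in>P. M x y * M y x * (\<Prod>t\<in>S - {x, y}. M t t))"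
proof -
  define \<tau> where "\<tau> = (\<lambda>(x :: 'a, y). transpose x y)"
  have finP: "finite P" using S P by (meson finite_SigmaI finite_Int finite_subset)
  have inj: "inj_on \<tau> P"
  proof (rule inj_onI, clarify)
    fix x y x' y' assume m: "(x, y) \<in> P" "(x', y') \<in> P" and eq: "\<tau> (x, y) = \<tau> (x', y')"
    from eq have "transpose x y = transpose x' y'" by (simp add: \<tau>_def)
    then have "transpose x' y' x = y" "transpose x' y' y = x"
      by (metis transpose_apply_first, metis transpose_apply_second)
    then show "x = x' \<and> y = y'" using m P XY by (auto simp: transpose_def split: if_splits)
  qed
  have noid: "id \<notin> \<tau> ` P"
  proof
    assume "id \<in> \<tau> ` P"
    then obtain x y where xy: "(x, y) \<in> P" "transpose x y = id" by (auto simp: \<tau>_def)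
    then have "x = y" by (metis id_apply transpose_apply_first)
    with xy P XY show False by auto
  qed
  have sub: "insert id (\<tau> ` P) \<subseteq> {\<sigma>. \<sigma> permutes S}"
    using P by (auto simp: \<tau>_def permutes_id intro!: permutes_swap_id)
  have tr: "(\<Prod>t\<in>S. M t (\<tau> (x, y) t)) = M x y * M y x * (\<Prod>t\<in>S - {x, y}. M t t)"
    if "(x, y) \<in> P" for x y
  proof -
    have xy: "x \<in> S" "y \<in> S" "x \<noteq> y" using that P XY by auto
    have "S = insert x (insert y (S - {x, y}))" using xy by auto
    then have "(\<Prod>t\<in>S. M t (\<tau> (x, y) t)) = (\<Prod>t\<in>insert x (insert y (S - {x, y})). M t (\<tau> (x, y) t))" by simp
    also have "\<dots> = M x y * (M y x * (\<Prod>t\<in>S - {x, y}. M t (\<tau> (x, y) t)))"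
      using S xy by (simp add: \<tau>_def)
    also have "(\<Prod>t\<in>S - {x, y}. M t (\<tau> (x, y) t)) = (\<Prod>t\<in>S - {x, y}. M t t)"
      by (rule prod.cong) (auto simp: \<tau>_def transpose_def)
    finally show ?thesis by simp
  qed
  have "(\<Prod>t\<in>S. M t t) + (\<Sum>(x, y)\<in>P. M x y * M y x * (\<Prod>t\<in>S - {x, y}. M t t))
      = (\<Prod>t\<in>S. M t t) + (\<Sum>z\<in>P. \<Prod>t\<in>S. M t (\<tau> z t))"
    by (simp, rule sum.cong) (auto simp: tr)
  also have "\<dots> = (\<Sum>\<sigma>\<in>insert id (\<tau> ` P). \<Prod>t\<in>S. M t (\<sigma> t))"
    using finP noid inj by (simp add: sum.reindex o_def)
  also have "\<dots> \<le> per M S"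
    unfolding per_def
    by (rule sum_mono2) (use S sub nonneg in \<open>auto simp: finite_permutations intro!: prod_nonneg\<close>)
  finally show ?thesis .
qed

subsection \<open>The signless Laplacian\<close>

definition signless_laplacian :: "'a set set \<Rightarrow> 'a \<Rightarrow> 'a \<Rightarrow> int" where
  "signless_laplacian E u v = (if u = v then int (degree E u) else if {u, v} \<in> E then 1 else 0)"

abbreviation perQ :: "'a set set \<Rightarrow> 'a set \<Rightarrow> int" where
  "perQ E S \<equiv> per (signless_laplacian E) S"

lemma perQ_nonneg: "0 \<le> perQ E S"
  by (rule per_nonneg) (simp add: signless_laplacian_def)

text \<open>Conjugating by the diagonal matrix that is \<open>1\<close> on one part and \<open>-1\<close> on the other
  removes all signs.\<close>
lemma per_laplacian_bipartite:
  assumes "finite S" "X \<inter> Y = {}" "\<forall>e\<in>E. \<exists>x\<in>X. \<exists>y\<in>Y. e = {x, y}"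
  shows "per (laplacian E) S = perQ E S"
proof -
  define s where "s v = (if v \<in> X then 1 else - 1 :: int)" for v
  have s2: "s v * s v = 1" for v by (simp add: s_def)
  have entry: "laplacian E u v = s u * s v * signless_laplacian E u v" for u v
    using assms by (fastforce simp: laplacian_def signless_laplacian_def s_def doubleton_eq_iff)
  show ?thesis
    unfolding per_def
  proof (rule sum.cong[OF refl])
    fix \<sigma> assume "\<sigma> \<in> {\<sigma>. \<sigma> permutes S}"
    \<comment> \<open>Each vertex of \<open>S\<close> occurs once as a row and once as a column, so
      its two signs cancel.\<close>
    then have "(\<Prod>t\<in>S. s (\<sigma> t)) = (\<Prod>t\<in>S. s t)"
      using prod.permute[of \<sigma> S s] by (simp add: o_def)
    then have "(\<Prod>t\<in>S. s t * s (\<sigma> t)) = (\<Prod>t\<in>S. s t * s t)"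
      by (simp add: prod.distrib)
    then have "(\<Prod>t\<in>S. s t * s (\<sigma> t)) = 1"
      by (simp add: s2)
    then show "(\<Prod>t\<in>S. laplacian E t (\<sigma> t)) = (\<Prod>t\<in>S. signless_laplacian E t (\<sigma> t))"
      by (simp add: entry prod.distrib)
  qed
qed

section \<open>Attaching a pendant edge\<close>

lemma degree_insert_edge:
  assumes "finite E" "e \<notin> E"
  shows "degree (insert e E) w = (if w \<in> e then Suc (degree E w) else degree E w)"
proof -
  have "{e' \<in> insert e E. w \<in> e'} = (if w \<in> e then insert e {e' \<in> E. w \<in> e'} else {e' \<in> E. w \<in> e'})"
    by auto
  then show ?thesis using assms by (simp add: degree_def)
qed

lemma degree_eq_0: "w \<notin> \<Union>E \<Longrightarrow> degree E w = 0"
  unfolding degree_def by (metis (mono_tags, lifting) Union_iff card.empty empty_Collect_eq)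

context
  fixes E :: "'a set set" and l u :: 'a and S :: "'a set"
  assumes fin: "finite E" "finite S" and l: "l \<notin> \<Union>E" "l \<notin> S" and ul: "u \<noteq> l"
begin

lemma pendant_entries:
  shows "signless_laplacian (insert {l, u} E) l l = 1"
    and "signless_laplacian (insert {l, u} E) l u = 1"
    and "signless_laplacian (insert {l, u} E) u l = 1"
    and "t \<noteq> u \<Longrightarrow> t \<noteq> l \<Longrightarrow> signless_laplacian (insert {l, u} E) l t = 0"
    and "t \<noteq> u \<Longrightarrow> t \<noteq> l \<Longrightarrow> signless_laplacian (insert {l, u} E) t l = 0"
    and "signless_laplacian (insert {l, u} E) u u = signless_laplacian E u u + 1"
    and "s \<noteq> l \<Longrightarrow> t \<noteq> l \<Longrightarrow> s \<noteq> u \<or> t \<noteq> u \<Longrightarrow>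
      signless_laplacian (insert {l, u} E) s t = signless_laplacian E s t"
proof -
  have notin: "{l, u} \<notin> E" using l by auto
  note d = degree_insert_edge[OF fin(1) notin] degree_eq_0[OF l(1)]
  show "signless_laplacian (insert {l, u} E) l l = 1"
    and "signless_laplacian (insert {l, u} E) l u = 1"
    and "signless_laplacian (insert {l, u} E) u l = 1"
    and "t \<noteq> u \<Longrightarrow> t \<noteq> l \<Longrightarrow> signless_laplacian (insert {l, u} E) l t = 0"
    and "t \<noteq> u \<Longrightarrow> t \<noteq> l \<Longrightarrow> signless_laplacian (insert {l, u} E) t l = 0"
    and "signless_laplacian (insert {l, u} E) u u = signless_laplacian E u u + 1"
    and "s \<noteq> l \<Longrightarrow> t \<noteq> l \<Longrightarrow> s \<noteq> u \<or> t \<noteq> u \<Longrightarrow>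
      signless_laplacian (insert {l, u} E) s t = signless_laplacian E s t"
    using ul l d by (auto simp: signless_laplacian_def doubleton_eq_iff insert_commute)
qed

private lemma not_l: "t \<in> S \<Longrightarrow> t \<noteq> l"
  using l by auto

text \<open>The row of \<open>l\<close> is absent, but the edge at \<open>l\<close> still counts in
  the degree of \<open>u\<close>, which raises one diagonal entry by 1.\<close>

lemma perQ_pendant_removed:
  "perQ (insert {l, u} E) S = (if u \<in> S then perQ E S + perQ E (S - {u}) else perQ E S)"
proof (cases "u \<in> S")
  case True
  have "perQ (insert {l, u} E) S = perQ E S + 1 * perQ E (S - {u})"
    by (rule per_diag_increment) (use fin True l in \<open>auto simp: pendant_entries not_l\<close>)
  with True show ?thesis by simp
next
  case False
  then show ?thesis using l by (auto intro!: per_cong pendant_entries)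
qed

text \<open>Expansion along \<open>l\<close> leaves permanents on \<open>S\<close> and
  \<open>S - {u}\<close>; the first still contains the raised degree of \<open>u\<close> and yields
  a second copy of \<open>perQ E (S - {u})\<close>, hence the factor 2. If \<open>u\<close> is
  already deleted, \<open>l\<close> is isolated with diagonal entry 1.\<close>

lemma perQ_pendant:
  "perQ (insert {l, u} E) (insert l S) =
    (if u \<in> S then perQ E S + 2 * perQ E (S - {u}) else perQ E S)"
proof (cases "u \<in> S")
  case True
  have "perQ (insert {l, u} E) (insert l S) =
      1 * perQ (insert {l, u} E) S + 1 * 1 * perQ (insert {l, u} E) (S - {u})"
    by (subst per_insert_pendant[OF fin(2) l(2) True]) (use l in \<open>auto simp: pendant_entries not_l\<close>)
  moreover have "perQ (insert {l, u} E) (S - {u}) = perQ E (S - {u})"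
    by (rule per_cong) (use l in \<open>auto simp: pendant_entries not_l\<close>)
  ultimately show ?thesis using True by (simp add: perQ_pendant_removed)
next
  case False
  have "perQ (insert {l, u} E) (insert l S) = signless_laplacian (insert {l, u} E) l l * perQ (insert {l, u} E) S"
    by (rule per_insert_isolated) (use fin l False in \<open>auto intro!: pendant_entries\<close>)
  with False show ?thesis by (simp add: pendant_entries perQ_pendant_removed)
qed

end

subsection \<open>Unicyclic bipartite graphs\<close>

text \<open>Connectivity is expressed through cuts, which makes it easy to preserve when a leaf is removed.\<close>
definition bip_unicyclic :: "'a set \<Rightarrow> 'a set \<Rightarrow> 'a set set \<Rightarrow> bool" where
  "bip_unicyclic X Y E \<longleftrightarrow> finite X \<and> finite Y \<and> X \<inter> Y = {} \<and> X \<noteq> {} \<and> Y \<noteq> {}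
    \<and> (\<forall>e\<in>E. \<exists>x\<in>X. \<exists>y\<in>Y. e = {x, y})
    \<and> (\<forall>S. S \<noteq> {} \<and> S \<subset> X \<union> Y \<longrightarrow> (\<exists>e\<in>E. e \<inter> S \<noteq> {} \<and> e - S \<noteq> {}))
    \<and> card E = card X + card Y"

lemma bip_unicyclic_swap: "bip_unicyclic X Y E \<Longrightarrow> bip_unicyclic Y X E"
  unfolding bip_unicyclic_def by (simp add: Un_commute Int_commute add.commute) (metis insert_commute)

context
  fixes X Y :: "'a set" and E
  assumes B: "bip_unicyclic X Y E"
begin

lemma bip_finite: "finite X" "finite Y" "X \<inter> Y = {}" "X \<noteq> {}" "Y \<noteq> {}"
  using B by (auto simp: bip_unicyclic_def)

lemma bip_edgeE:
  assumes "e \<in> E"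
  obtains x y where "x \<in> X" "y \<in> Y" "e = {x, y}"
  using B assms by (meson bip_unicyclic_def)

lemma bip_card_edges: "card E = card X + card Y"
  using B by (simp add: bip_unicyclic_def)

lemma bip_edges_subset: "E \<subseteq> (\<lambda>(x, y). {x, y}) ` (X \<times> Y)"
  by (auto elim!: bip_edgeE)

lemma bip_finite_edges: "finite E"
  using bip_edges_subset bip_finite by (meson finite_SigmaI finite_imageI finite_subset)

text \<open>The \<open>p + q\<close> edges lie among \<open>p q\<close> pairs, and
  \<open>p + q \<le> p q\<close> fails when one part is a single vertex.\<close>

lemma bip_cards: "2 \<le> card X" "2 \<le> card Y"
proof -
  have "card E \<le> card (X \<times> Y)"
    using bip_edges_subset bip_finite by (meson card_image_le card_mono finite_SigmaI finite_imageI le_trans)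
  then have "card X + card Y \<le> card X * card Y"
    by (simp add: bip_card_edges card_cartesian_product)
  moreover have "card X > 0" "card Y > 0" using bip_finite by (auto simp: card_gt_0_iff)
  ultimately have "card X \<noteq> 1" "card Y \<noteq> 1" "card X > 0" "card Y > 0" by auto
  then show "2 \<le> card X" "2 \<le> card Y" by auto
qed

text \<open>Some edge crosses the cut \<open>{v}\<close>, which is a proper subset because a part
  has at least two vertices.\<close>

lemma bip_degree_pos:
  assumes "v \<in> X \<union> Y" shows "degree E v > 0"
proof -
  have "{v} \<noteq> X \<union> Y"
  proof
    assume "{v} = X \<union> Y"
    then have "X \<subseteq> {v}" "Y \<subseteq> {v}" by auto
    then show False using bip_cards card_mono[of "{v}" X] by simp
  qed
  with assms have "{v} \<noteq> {} \<and> {v} \<subset> X \<union> Y" by auto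
  with B obtain e where "e \<in> E" "e \<inter> {v} \<noteq> {}" unfolding bip_unicyclic_def by metis
  then show ?thesis using bip_finite_edges by (auto simp: degree_def card_gt_0_iff)
qed

text \<open>Each edge has exactly one end in \<open>X\<close>, so the edge sets at the vertices of
  \<open>X\<close> partition \<open>E\<close>.\<close>

lemma bip_degree_sum: "(\<Sum>x\<in>X. degree E x) = card E"
proof -
  have "E \<subseteq> (\<Union>x\<in>X. {e \<in> E. x \<in> e})"
  proof
    fix e assume "e \<in> E"
    then obtain x y where "x \<in> X" "e = {x, y}" by (rule bip_edgeE)
    with \<open>e \<in> E\<close> show "e \<in> (\<Union>x\<in>X. {e \<in> E. x \<in> e})" by auto
  qed
  then have "E = (\<Union>x\<in>X. {e \<in> E. x \<in> e})" by auto
  then have "card E = card (\<Union>x\<in>X. {e \<in> E. x \<in> e})" by simp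
  also have "\<dots> = (\<Sum>x\<in>X. card {e \<in> E. x \<in> e})"
    using bip_finite bip_finite_edges
    by (intro card_UN_disjoint) (auto elim!: bip_edgeE)
  finally show ?thesis by (simp add: degree_def)
qed

text \<open>This is the contribution of the identity permutation, obtained with an empty set of
  pairs.\<close>

lemma perQ_ge_prod: "finite S \<Longrightarrow> (\<Prod>t\<in>S. int (degree E t)) \<le> perQ E S"
  using per_ge_transpositions[of S "signless_laplacian E" "{}" "{}" "{}"]
  by (simp add: signless_laplacian_def)

lemma perQ_pos:
  assumes "S \<subseteq> X \<union> Y" shows "1 \<le> perQ E S"
proof -
  have "finite S" using assms bip_finite by (meson finite_Un finite_subset)
  have "0 < (\<Prod>t\<in>S. int (degree E t))"
    by (rule prod_pos) (use assms bip_degree_pos in auto)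
  with perQ_ge_prod[OF \<open>finite S\<close>] show ?thesis by linarith
qed

lemma remove_leaf:
  assumes l: "l \<in> Y" "degree E l = 1"
  obtains u E' where "u \<in> X" "E = insert {l, u} E'" "l \<notin> \<Union>E'" "bip_unicyclic X (Y - {l}) E'"
proof -
  obtain e where e: "{e \<in> E. l \<in> e} = {e}"
    using l(2) unfolding degree_def by (auto simp: card_1_singleton_iff)
  then have "e \<in> E" "l \<in> e" by auto
  then obtain u where u: "u \<in> X" "e = {l, u}" using l bip_finite by (auto elim!: bip_edgeE)
  define E' where "E' = E - {e}"
  have E: "E = insert {l, u} E'" using \<open>e \<in> E\<close> u by (auto simp: E'_def)
  have lE': "l \<notin> \<Union>E'" using e by (auto simp: E'_def)
  have cE': "card E' + 1 = card E" using \<open>e \<in> E\<close> bip_finite_edges card_gt_0_iff[of E] by (auto simp: E'_def)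
  have cY: "card (Y - {l}) + 1 = card Y" using l bip_finite card_gt_0_iff[of Y] by auto
  have "Y - {l} \<noteq> {}"
  proof
    assume "Y - {l} = {}"
    then have "card (Y - {l}) = 0" by (simp only: card.empty)
    then show False using cY bip_cards by simp
  qed
  have cut: "\<exists>e\<in>E'. e \<inter> S \<noteq> {} \<and> e - S \<noteq> {}" if S: "S \<noteq> {}" "S \<subset> X \<union> (Y - {l})" for S
  proof -
    have lS: "l \<notin> S" using S l bip_finite by auto
    \<comment> \<open>The leaf \<open>l\<close> is put on the side of its neighbour
      \<open>u\<close>, so that the edge between them never crosses and the crossing edge survives
      in \<open>E'\<close>.\<close>
    define T where "T = (if u \<in> S then insert l S else S)"
    have "T \<noteq> {} \<and> T \<subset> X \<union> Y"
      using S l u lS bip_finite(3) by (auto simp: T_def)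
    then obtain f where f: "f \<in> E" "f \<inter> T \<noteq> {}" "f - T \<noteq> {}"
      using B unfolding bip_unicyclic_def by metis
    have "f \<noteq> {l, u}" using f lS by (auto simp: T_def split: if_splits)
    then have "f \<in> E'" using f E by auto
    then have "l \<notin> f" using lE' by auto
    with f \<open>f \<in> E'\<close> show ?thesis by (auto simp: T_def split: if_splits)
  qed
  have ed: "\<exists>x\<in>X. \<exists>y\<in>Y - {l}. f = {x, y}" if "f \<in> E'" for f
  proof -
    have "f \<in> E" "l \<notin> f" using that lE' by (auto simp: E'_def)
    then show ?thesis by (auto elim!: bip_edgeE)
  qed
  have "bip_unicyclic X (Y - {l}) E'"
    unfolding bip_unicyclic_def
    using bip_finite \<open>Y - {l} \<noteq> {}\<close> cut ed cE' cY bip_card_edges by auto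
  with u E lE' show ?thesis by (intro that)
qed

text \<open>Without leaves every degree is at least 2, so \<open>2 p \<le> p + q\<close> and
  \<open>2 q \<le> p + q\<close>; hence \<open>p = q\<close> and no degree can exceed 2. The degree
  sum over \<open>Y\<close> is a hypothesis because it comes from the graph with the parts
  exchanged.\<close>

lemma two_regular:
  assumes "\<And>v. v \<in> X \<union> Y \<Longrightarrow> degree E v \<noteq> 1"
    and sumY: "(\<Sum>y\<in>Y. degree E y) = card E"
  shows "card X = card Y" and "v \<in> X \<union> Y \<Longrightarrow> degree E v = 2"
proof -
  have ge: "2 \<le> degree E v" if "v \<in> X \<union> Y" for v
    using assms(1)[OF that] bip_degree_pos[OF that] by linarith
  have "2 * card X \<le> card E" 
    unfolding bip_degree_sum[symmetric] using sum_mono[of X "\<lambda>_. 2" "degree E"] ge by simp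
  moreover have "2 * card Y \<le> card E"
    unfolding sumY[symmetric] using sum_mono[of Y "\<lambda>_. 2" "degree E"] ge by simp
  ultimately show eq: "card X = card Y" using bip_card_edges by linarith
  have eX: "(\<Sum>x\<in>X. 2) = (\<Sum>x\<in>X. degree E x)" using bip_degree_sum bip_card_edges eq by simp
  have eY: "(\<Sum>x\<in>Y. 2) = (\<Sum>x\<in>Y. degree E x)" using sumY bip_card_edges eq by simp
  have "\<forall>v\<in>X. degree E v = 2" "\<forall>v\<in>Y. degree E v = 2"
    using sum_mono_inv[OF eX] sum_mono_inv[OF eY] ge bip_finite by auto
  then show "v \<in> X \<union> Y \<Longrightarrow> degree E v = 2" by auto
qed

text \<open>On a subset the identity suffices. On all vertices the transpositions of the
  \<open>p + q\<close> edges are added, each contributing \<open>2 ^ (p + q - 2)\<close>.\<close>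

lemma perQ_regular:
  assumes reg: "\<And>v. v \<in> X \<union> Y \<Longrightarrow> degree E v = 2"
  shows "S \<subseteq> X \<union> Y \<Longrightarrow> 2 ^ card S \<le> perQ E S"
    and "perQ E (X \<union> Y) \<ge> 2 ^ (card X + card Y) + int (card X + card Y) * 2 ^ (card X + card Y - 2)"
proof -
  show "2 ^ card S \<le> perQ E S" if "S \<subseteq> X \<union> Y"
  proof -
    have "finite S" using that bip_finite by (meson finite_Un finite_subset)
    moreover have "(\<Prod>t\<in>S. int (degree E t)) = (\<Prod>t\<in>S. 2)"
      by (rule prod.cong) (use reg that in auto)
    ultimately show ?thesis using perQ_ge_prod[of S] by simp
  qed
  \<comment> \<open>\<open>P\<close> lists each edge once, with its end in \<open>X\<close>
    first.\<close>
  define P where "P = {(x, y) \<in> X \<times> Y. {x, y} \<in> E}"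
  have "bij_betw (\<lambda>(x, y). {x, y}) P E"
    unfolding bij_betw_def
  proof
    show "inj_on (\<lambda>(x, y). {x, y}) P"
      using bip_finite(3) by (auto simp: inj_on_def P_def doubleton_eq_iff)
    show "(\<lambda>(x, y). {x, y}) ` P = E"
    proof
      show "E \<subseteq> (\<lambda>(x, y). {x, y}) ` P"
      proof
        fix e assume e: "e \<in> E"
        then obtain x y where "x \<in> X" "y \<in> Y" "e = {x, y}" by (rule bip_edgeE)
        with e show "e \<in> (\<lambda>(x, y). {x, y}) ` P" by (auto simp: P_def intro!: image_eqI[of _ _ "(x, y)"])
      qed
    qed (auto simp: P_def)
  qed
  then have cP: "card P = card X + card Y" using bip_card_edges by (simp add: bij_betw_same_card)
  let ?V = "X \<union> Y" and ?Q = "signless_laplacian E"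
  have cV: "card ?V = card X + card Y" using bip_finite by (simp add: card_Un_disjoint)
  have "perQ E ?V \<ge> (\<Prod>t\<in>?V. ?Q t t) + (\<Sum>(x, y)\<in>P. ?Q x y * ?Q y x * (\<Prod>t\<in>?V - {x, y}. ?Q t t))"
    by (rule per_ge_transpositions[of _ _ X Y])
      (use bip_finite in \<open>auto simp: P_def signless_laplacian_def\<close>)
  also have "(\<Prod>t\<in>?V. ?Q t t) = (\<Prod>t\<in>?V. 2)"
    by (rule prod.cong) (use reg in \<open>auto simp: signless_laplacian_def\<close>)
  also have "(\<Sum>(x, y)\<in>P. ?Q x y * ?Q y x * (\<Prod>t\<in>?V - {x, y}. ?Q t t))
      = (\<Sum>(x, y)\<in>P. 2 ^ (card X + card Y - 2))"
  proof (rule sum.cong[OF refl], clarify)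
    fix x y assume "(x, y) \<in> P"
    then have xy: "x \<in> X" "y \<in> Y" "x \<noteq> y" "{x, y} \<in> E" "{y, x} \<in> E"
      using bip_finite by (auto simp: P_def insert_commute)
    have "(\<Prod>t\<in>?V - {x, y}. ?Q t t) = (\<Prod>t\<in>?V - {x, y}. 2)"
      by (rule prod.cong) (use reg in \<open>auto simp: signless_laplacian_def\<close>)
    also have "\<dots> = 2 ^ (card X + card Y - 2)"
      using xy cV by (simp add: card_Diff_subset)
    finally show "?Q x y * ?Q y x * (\<Prod>t\<in>?V - {x, y}. ?Q t t) = 2 ^ (card X + card Y - 2)"
      using xy by (simp add: signless_laplacian_def)
  qed
  finally show "perQ E (X \<union> Y) \<ge> 2 ^ (card X + card Y) + int (card X + card Y) * 2 ^ (card X + card Y - 2)"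
    by (simp add: cV cP split_def)
qed

end

subsection \<open>The extremal graph\<close>

text \<open>\<open>B(p, q)\<close> with \<open>v\<^sub>1 = y1\<close>, \<open>v\<^sub>2 = x1\<close>, \<open>v\<^sub>3 = y2\<close>, \<open>v\<^sub>4 = x2\<close>: a double star with
  adjacent centres \<open>x1\<close>, \<open>y1\<close>, plus one edge between two leaves.\<close>
definition double_star_plus :: "'a \<Rightarrow> 'a \<Rightarrow> 'a \<Rightarrow> 'a \<Rightarrow> 'a set \<Rightarrow> 'a set \<Rightarrow> 'a set set" where
  "double_star_plus x1 x2 y1 y2 X Y = (\<lambda>y. {x1, y}) ` Y \<union> (\<lambda>x. {x, y1}) ` X \<union> {{x2, y2}}"

lemma double_star_plus_swap:
  "double_star_plus x1 x2 y1 y2 X Y = double_star_plus y1 y2 x1 x2 Y X"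
  unfolding double_star_plus_def by (auto simp: insert_commute)

text \<open>With centres \<open>x1\<close> and \<open>y1\<close>, these four values form a closed
  system: attaching a pendant vertex at a centre determines the new ones from the old ones. They are
  the bounds of \<open>perQ_bounds\<close>, attained.\<close>

definition extremal_values :: "'a \<Rightarrow> 'a \<Rightarrow> 'a set \<Rightarrow> 'a set \<Rightarrow> 'a set set \<Rightarrow> bool" where
  "extremal_values x1 y1 X Y E \<longleftrightarrow>
    perQ E (X \<union> Y) = 20 * (int (card X) - 1) * (int (card Y) - 1) + 4 * (int (card X) + int (card Y))
    \<and> perQ E (X \<union> Y - {x1}) = 10 * (int (card X) - 1) + 2
    \<and> perQ E (X \<union> Y - {y1}) = 10 * (int (card Y) - 1) + 2
    \<and> perQ E (X \<union> Y - {x1, y1}) = 5"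

lemma extremal_values_swap: "extremal_values x1 y1 X Y E \<Longrightarrow> extremal_values y1 x1 Y X E"
  unfolding extremal_values_def by (simp add: Un_commute insert_commute algebra_simps)

text \<open>The 4-cycle starts the construction; its values 36, 12, 12 and 5 come from full
  enumeration of the permutations.\<close>

lemma extremal_values_K22:
  assumes "distinct [x1, x2, y1, y2]"
  shows "extremal_values x1 y1 {x1, x2} {y1, y2} (double_star_plus x1 x2 y1 y2 {x1, x2} {y1, y2})"
proof -
  let ?E = "double_star_plus x1 x2 y1 y2 {x1, x2} {y1, y2}"
  have E: "?E = {{x1, y1}, {x1, y2}, {x2, y1}, {x2, y2}}" by (auto simp: double_star_plus_def)
  have d: "x1 \<noteq> x2" "x1 \<noteq> y1" "x1 \<noteq> y2" "x2 \<noteq> y1" "x2 \<noteq> y2" "y1 \<noteq> y2"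
    "x2 \<noteq> x1" "y1 \<noteq> x1" "y2 \<noteq> x1" "y1 \<noteq> x2" "y2 \<noteq> x2" "y2 \<noteq> y1" using assms by auto
  have S: "{e \<in> ?E. x1 \<in> e} = {{x1, y1}, {x1, y2}}" "{e \<in> ?E. x2 \<in> e} = {{x2, y1}, {x2, y2}}"
    "{e \<in> ?E. y1 \<in> e} = {{x1, y1}, {x2, y1}}" "{e \<in> ?E. y2 \<in> e} = {{x1, y2}, {x2, y2}}"
    unfolding E using d by auto
  have deg: "degree ?E x1 = 2" "degree ?E x2 = 2" "degree ?E y1 = 2" "degree ?E y2 = 2"
    unfolding degree_def S using d by (auto simp: doubleton_eq_iff card_insert_if)
  define Q where "Q = signless_laplacian ?E"
  have Q: "Q x1 x1 = 2" "Q x2 x2 = 2" "Q y1 y1 = 2" "Q y2 y2 = 2"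
    "Q x1 y1 = 1" "Q x1 y2 = 1" "Q x2 y1 = 1" "Q x2 y2 = 1"
    "Q y1 x1 = 1" "Q y2 x1 = 1" "Q y1 x2 = 1" "Q y2 x2 = 1"
    "Q x1 x2 = 0" "Q x2 x1 = 0" "Q y1 y2 = 0" "Q y2 y1 = 0"
    unfolding Q_def signless_laplacian_def deg using d by (auto simp: E doubleton_eq_iff)
  have V: "{x1, x2} \<union> {y1, y2} = {x1, x2, y1, y2}" "{x1, x2} \<union> {y1, y2} - {x1} = {x2, y1, y2}"
    "{x1, x2} \<union> {y1, y2} - {y1} = {y2, x1, x2}" "{x1, x2} \<union> {y1, y2} - {x1, y1} = {x2, y2}"
    using d by auto
  have c: "card {x1, x2} = 2" "card {y1, y2} = 2" using d by auto
  have "per Q {x1, x2, y1, y2} = 36" "per Q {x2, y1, y2} = 12" "per Q {y2, x1, x2} = 12" "per Q {x2, y2} = 5"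
    unfolding per_def using d
    by (simp_all add: sum_over_permutations_insert Q transpose_def permutes_empty)
  then show ?thesis unfolding extremal_values_def Q_def by (simp only: V(2-4) c, simp only: V(1)) simp
qed

text \<open>By \<open>perQ_pendant\<close> the whole permanent grows by
  \<open>2 (10 (p - 1) + 2)\<close>, the one without \<open>y1\<close> by \<open>2 * 5\<close>, and
  the two without \<open>x1\<close> stay fixed because \<open>y\<close> is isolated there.\<close>

lemma extremal_values_insert:
  assumes fin: "finite X" "finite Y" "finite E" and XY: "X \<inter> Y = {}" "x1 \<in> X" "y1 \<in> Y"
    and y: "y \<notin> X \<union> Y" "y \<notin> \<Union>E" and P: "extremal_values x1 y1 X Y E"
  shows "extremal_values x1 y1 X (insert y Y) (insert {y, x1} E)"
proof -
  have ne: "x1 \<noteq> y" "y1 \<noteq> y" "x1 \<noteq> y1" using XY y by auto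
  have V: "X \<union> insert y Y = insert y (X \<union> Y)"
    "X \<union> insert y Y - {x1} = insert y (X \<union> Y - {x1})"
    "X \<union> insert y Y - {y1} = insert y (X \<union> Y - {y1})"
    "X \<union> insert y Y - {x1, y1} = insert y (X \<union> Y - {x1, y1})" using ne by auto
  have pend: "perQ (insert {y, x1} E) (insert y S) =
    (if x1 \<in> S then perQ E S + 2 * perQ E (S - {x1}) else perQ E S)" if "S \<subseteq> X \<union> Y" for S
    by (rule perQ_pendant) (use fin y ne that in \<open>auto intro: finite_subset\<close>)
  have D: "X \<union> Y - {y1} - {x1} = X \<union> Y - {x1, y1}" by auto
  show ?thesis
    using P XY fin y ne unfolding extremal_values_def
    by (simp only: V(2-4), simp only: V(1)) (simp add: pend D Diff_subset algebra_simps)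
qed

lemma extremal_values_grow:
  assumes "finite F" "finite X" "finite Y" "finite E" "X \<inter> Y = {}" "x1 \<in> X" "y1 \<in> Y"
    "F \<inter> (X \<union> Y) = {}" "\<Union>E \<subseteq> X \<union> Y" "extremal_values x1 y1 X Y E"
  shows "extremal_values x1 y1 X (Y \<union> F) ((\<lambda>y. {y, x1}) ` F \<union> E)"
  using assms
proof (induction F)
  case (insert y F)
  have "extremal_values x1 y1 X (insert y (Y \<union> F)) (insert {y, x1} ((\<lambda>y. {y, x1}) ` F \<union> E))"
    by (rule extremal_values_insert) (use insert in auto)
  then show ?case by simp
qed simp

text \<open>The graph is grown from the 4-cycle: first the further vertices of \<open>Y\<close> are
  hung on \<open>x1\<close>, then, with the parts exchanged, those of \<open>X\<close> on
  \<open>y1\<close>.\<close>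

lemma extremal_values_double_star_plus:
  assumes fin: "finite X" "finite Y" and XY: "X \<inter> Y = {}"
    and "x1 \<in> X" "x2 \<in> X" "x1 \<noteq> x2" "y1 \<in> Y" "y2 \<in> Y" "y1 \<noteq> y2"
  shows "extremal_values x1 y1 X Y (double_star_plus x1 x2 y1 y2 X Y)"
proof -
  define E1 where "E1 = double_star_plus x1 x2 y1 y2 {x1, x2} {y1, y2}"
  define E2 where "E2 = (\<lambda>y. {y, x1}) ` (Y - {y1, y2}) \<union> E1"
  have E1: "finite E1" "\<Union>E1 \<subseteq> {x1, x2} \<union> {y1, y2}" by (auto simp: E1_def double_star_plus_def)
  have Y: "{y1, y2} \<union> (Y - {y1, y2}) = Y" and X: "{x1, x2} \<union> (X - {x1, x2}) = X" using assms by auto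
  have v1: "extremal_values x1 y1 {x1, x2} {y1, y2} E1"
    unfolding E1_def by (rule extremal_values_K22) (use assms in auto)
  have v2: "extremal_values x1 y1 {x1, x2} ({y1, y2} \<union> (Y - {y1, y2})) E2"
    unfolding E2_def by (rule extremal_values_grow[OF _ _ _ E1(1) _ _ _ _ E1(2) v1]) (use assms in auto)
  have E2: "finite E2" "\<Union>E2 \<subseteq> Y \<union> {x1, x2}" using E1 assms by (auto simp: E2_def)
  have "extremal_values y1 x1 Y ({x1, x2} \<union> (X - {x1, x2})) ((\<lambda>y. {y, y1}) ` (X - {x1, x2}) \<union> E2)"
    by (rule extremal_values_grow[OF _ _ _ E2(1) _ _ _ _ E2(2) extremal_values_swap[OF v2[unfolded Y]]])
      (use assms in auto)
  moreover have "(\<lambda>y. {y, y1}) ` (X - {x1, x2}) \<union> E2 = double_star_plus x1 x2 y1 y2 X Y"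
    using assms unfolding E2_def E1_def double_star_plus_def by (auto simp: insert_commute)
  ultimately show ?thesis using extremal_values_swap by (metis X)
qed

definition double_star_plus_graph :: "'a set \<Rightarrow> 'a set \<Rightarrow> 'a set set \<Rightarrow> bool" where
  "double_star_plus_graph X Y E \<longleftrightarrow> (\<exists>x1\<in>X. \<exists>x2\<in>X. \<exists>y1\<in>Y. \<exists>y2\<in>Y. x1 \<noteq> x2 \<and> y1 \<noteq> y2
    \<and> E = double_star_plus x1 x2 y1 y2 X Y)"

lemma double_star_plus_graph_swap: "double_star_plus_graph X Y E \<Longrightarrow> double_star_plus_graph Y X E"
  unfolding double_star_plus_graph_def using double_star_plus_swap by metis

subsection \<open>Lower bounds\<close>

text \<open>Each deletion bound is demanded for every vertex, not only for centres, because a leaf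
  may hang anywhere.\<close>

definition perQ_bounds :: "'a set \<Rightarrow> 'a set \<Rightarrow> 'a set set \<Rightarrow> bool" where
  "perQ_bounds X Y E \<longleftrightarrow>
    20 * (int (card X) - 1) * (int (card Y) - 1) + 4 * (int (card X) + int (card Y)) \<le> perQ E (X \<union> Y)
    \<and> (\<forall>v\<in>X. 10 * (int (card X) - 1) + 2 \<le> perQ E (X \<union> Y - {v}))
    \<and> (\<forall>v\<in>Y. 10 * (int (card Y) - 1) + 2 \<le> perQ E (X \<union> Y - {v}))
    \<and> (\<forall>v\<in>X. \<forall>w\<in>Y. 5 \<le> perQ E (X \<union> Y - {v, w}))"

lemma perQ_bounds_swap: "perQ_bounds X Y E \<Longrightarrow> perQ_bounds Y X E"
  unfolding perQ_bounds_def by (simp add: Un_commute algebra_simps) (metis insert_commute)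

text \<open>Four edges fill all four pairs, so the graph is the 4-cycle, in which any two vertices
  from different parts can serve as centres.\<close>

lemma bip_unicyclic_K22:
  assumes B: "bip_unicyclic X Y E" and c: "card X = 2" "card Y = 2" and xy: "x \<in> X" "y \<in> Y"
  obtains x2 y2 where "x2 \<in> X" "x \<noteq> x2" "y2 \<in> Y" "y \<noteq> y2" "E = double_star_plus x x2 y y2 X Y"
proof -
  obtain x2 where x2: "X = {x, x2}" "x \<noteq> x2" using c xy by (auto simp: card_2_iff)
  obtain y2 where y2: "Y = {y, y2}" "y \<noteq> y2" using c xy by (auto simp: card_2_iff)
  note f = bip_finite[OF B]
  have "card ((\<lambda>(x, y). {x, y}) ` (X \<times> Y)) \<le> card (X \<times> Y)"
    by (rule card_image_le) (use f in auto)
  also have "\<dots> = card E" using c by (simp add: bip_card_edges[OF B] card_cartesian_product)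
  finally have "E = (\<lambda>(x, y). {x, y}) ` (X \<times> Y)"
    using f by (intro card_seteq[OF _ bip_edges_subset[OF B]]) auto
  also have "\<dots> = double_star_plus x x2 y y2 X Y"
    by (auto simp: double_star_plus_def x2 y2)
  finally show ?thesis using x2 y2 by (intro that[of x2 y2]) auto
qed

text \<open>Equality holds at \<open>k = 3\<close>. The linear bound reduces the estimates for
  longer cycles to polynomial ones.\<close>

lemma four_power_ge:
  assumes "3 \<le> k" shows "10 * int k - 14 \<le> 4 ^ (k - 1)"
  using assms
proof (induction k rule: nat_induct_at_least)
  case (Suc n)
  then have "(4 :: int) ^ (Suc n - 1) = 4 * 4 ^ (n - 1)" by (cases n) auto
  with Suc show ?case by simp
qed simp

lemma perQ_bounds_regular:
  assumes B: "bip_unicyclic X Y E" and reg: "\<And>v. v \<in> X \<union> Y \<Longrightarrow> degree E v = 2"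
    and eq: "card X = card Y"
  shows "perQ_bounds X Y E" and "card X \<noteq> 2 \<Longrightarrow>
    20 * (int (card X) - 1) * (int (card Y) - 1) + 4 * (int (card X) + int (card Y)) < perQ E (X \<union> Y)"
proof -
  note f = bip_finite[OF B]
  have "perQ_bounds X Y E" if c: "card X = 2"
  proof -
    have c': "card Y = 2" using eq c by simp
    \<comment> \<open>On the 4-cycle every such pair can be taken as centres, so the exact values
      hold whichever vertices are deleted.\<close>
    have val: "extremal_values x y X Y E" if xy: "x \<in> X" "y \<in> Y" for x y
    proof -
      obtain x2 y2 where "x2 \<in> X" "x \<noteq> x2" "y2 \<in> Y" "y \<noteq> y2" "E = double_star_plus x x2 y y2 X Y"
        by (rule bip_unicyclic_K22[OF B c c' xy])
      with f xy show ?thesis by (auto intro!: extremal_values_double_star_plus)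
    qed
    obtain x y where "x \<in> X" "y \<in> Y" using f by auto
    with val show ?thesis unfolding perQ_bounds_def extremal_values_def by (metis order.refl)
  qed
  moreover have "perQ_bounds X Y E \<and>
    20 * (int (card X) - 1) * (int (card Y) - 1) + 4 * (int (card X) + int (card Y)) < perQ E (X \<union> Y)"
    if "card X \<noteq> 2"
  proof -
    define k where "k = card X"
    have k: "3 \<le> k" "card X = k" "card Y = k" using that bip_cards[OF B] eq by (auto simp: k_def)
    define a :: int where "a = 4 ^ (k - 1)"
    have a: "10 * int k - 14 \<le> a" using four_power_ge[OF k(1)] by (simp add: a_def)
    obtain m where "k = Suc m" using k by (cases k) auto
    then have pow: "(2 :: int) ^ (2 * k - 2) = a" "(2 :: int) ^ (2 * k - 1) = 2 * a" "(2 :: int) ^ (2 * k) = 4 * a"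
      by (simp_all add: a_def power_mult)
    have cV: "card (X \<union> Y) = 2 * k" using f k by (simp add: card_Un_disjoint)
    \<comment> \<open>The difference of the two sides is \<open>44 k - 76\<close>, positive for
      \<open>k \<ge> 3\<close>.\<close>
    have "20 * (int k - 1) * (int k - 1) + 4 * (int k + int k) < (4 + 2 * int k) * (10 * int k - 14)"
      using k by (simp add: algebra_simps)
    also have "\<dots> \<le> (4 + 2 * int k) * a" using a by (intro mult_left_mono) auto
    also have "\<dots> \<le> perQ E (X \<union> Y)"
      using perQ_regular(2)[OF B reg] k pow by (simp add: algebra_simps mult_2[symmetric])
    finally have main: "20 * (int k - 1) * (int k - 1) + 4 * (int k + int k) < perQ E (X \<union> Y)" .
    have one: "10 * (int k - 1) + 2 \<le> perQ E (X \<union> Y - {v})" if "v \<in> X \<union> Y" for v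
    proof -
      have "card (X \<union> Y - {v}) = 2 * k - 1" using that cV by (simp add: card_Diff_singleton)
      then have "2 * a \<le> perQ E (X \<union> Y - {v})"
        using perQ_regular(1)[OF B reg, of "X \<union> Y - {v}"] pow by auto
      with a k show ?thesis by simp
    qed
    have two: "5 \<le> perQ E (X \<union> Y - {v, w})" if "v \<in> X" "w \<in> Y" for v w
    proof -
      have "v \<noteq> w" using that f by auto
      then have "card (X \<union> Y - {v, w}) = 2 * k - 2" using that cV by (simp add: card_Diff_subset)
      then have "a \<le> perQ E (X \<union> Y - {v, w})"
        using perQ_regular(1)[OF B reg, of "X \<union> Y - {v, w}"] pow by auto
      with a k show ?thesis by simp
    qed
    show ?thesis using main one two unfolding perQ_bounds_def k by auto
  qed
  ultimately show "perQ_bounds X Y E" and "card X \<noteq> 2 \<Longrightarrow>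
    20 * (int (card X) - 1) * (int (card Y) - 1) + 4 * (int (card X) + int (card Y)) < perQ E (X \<union> Y)"
    by auto
qed

section \<open>Bounds after attaching a leaf\<close>

context
  fixes X Y :: "'a set" and l u E
  assumes B: "bip_unicyclic X Y E" and l: "l \<notin> X \<union> Y" "l \<notin> \<Union>E" and u: "u \<in> X"
begin

lemma perQ_attach:
  assumes "S \<subseteq> X \<union> Y"
  shows "perQ (insert {l, u} E) (insert l S) =
      (if u \<in> S then perQ E S + 2 * perQ E (S - {u}) else perQ E S)"
    and "perQ (insert {l, u} E) S = (if u \<in> S then perQ E S + perQ E (S - {u}) else perQ E S)"
proof -
  have "finite S" "l \<notin> S" "u \<noteq> l"
    using assms bip_finite[OF B] l u by (auto intro: finite_subset)
  then show "perQ (insert {l, u} E) (insert l S) =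
      (if u \<in> S then perQ E S + 2 * perQ E (S - {u}) else perQ E S)"
    and "perQ (insert {l, u} E) S = (if u \<in> S then perQ E S + perQ E (S - {u}) else perQ E S)"
    using bip_finite_edges[OF B] l perQ_pendant perQ_pendant_removed by metis+
qed

text \<open>The recursion supplies exactly the increments of the bounds:
  \<open>2 (10 (P - 1) + 2)\<close> for the whole permanent and \<open>2 * 5\<close> after deletion
  of an old vertex of \<open>Y\<close>. The other two bounds do not depend on the size of
  \<open>Y\<close>.\<close>

lemma perQ_bounds_attach:
  assumes bd: "perQ_bounds X Y E"
  shows "perQ_bounds X (insert l Y) (insert {l, u} E)"
proof -
  let ?E = "insert {l, u} E" and ?V = "X \<union> Y"
  define P Q where "P = int (card X)" and "Q = int (card Y)"
  have PQ: "2 \<le> P" "2 \<le> Q" using bip_cards[OF B] by (auto simp: P_def Q_def)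
  note f = bip_finite[OF B]
  have cl: "int (card (insert l Y)) = Q + 1" using f l by (simp add: Q_def)
  have V: "X \<union> insert l Y = insert l ?V" by auto
  have a: "20 * (P - 1) * (Q - 1) + 4 * (P + Q) \<le> perQ E ?V"
    and bX: "\<And>v. v \<in> X \<Longrightarrow> 10 * (P - 1) + 2 \<le> perQ E (?V - {v})"
    and bY: "\<And>v. v \<in> Y \<Longrightarrow> 10 * (Q - 1) + 2 \<le> perQ E (?V - {v})"
    and c: "\<And>v w. v \<in> X \<Longrightarrow> w \<in> Y \<Longrightarrow> 5 \<le> perQ E (?V - {v, w})"
    using bd by (auto simp: perQ_bounds_def P_def Q_def)
  have V1: "perQ ?E (insert l ?V) = perQ E ?V + 2 * perQ E (?V - {u})"
    using perQ_attach(1)[of ?V] u by simp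
  \<comment> \<open>Attaching a leaf never lowers a subpermanent, which carries over the bounds that
    do not change.\<close>
  have ge: "perQ E S \<le> perQ ?E (insert l S)" "perQ E S \<le> perQ ?E S" if "S \<subseteq> ?V" for S
    using perQ_attach[OF that] perQ_nonneg[of E "S - {u}"] by auto
  have 1: "20 * (P - 1) * Q + 4 * (P + (Q + 1)) \<le> perQ ?E (insert l ?V)"
    using a bX[OF u] V1 by (simp add: algebra_simps)
  have 2: "10 * (P - 1) + 2 \<le> perQ ?E (insert l ?V - {v})" if v: "v \<in> X" for v
  proof -
    have "insert l ?V - {v} = insert l (?V - {v})" using v l by auto
    with ge(1)[of "?V - {v}"] bX[OF v] show ?thesis by auto
  qed
  have 3: "10 * Q + 2 \<le> perQ ?E (insert l ?V - {v})" if v: "v \<in> insert l Y" for v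
  proof (cases "v = l")
    \<comment> \<open>Deleting \<open>l\<close> itself keeps the raised degree of \<open>u\<close>,
      so one extra copy of the permanent without \<open>u\<close> appears; as
      \<open>P \<ge> 2\<close>, the old bounds leave ample room.\<close>
    case True
    then have "insert l ?V - {v} = ?V" using l by auto
    then have "perQ ?E (insert l ?V - {v}) = perQ E ?V + perQ E (?V - {u})"
      using perQ_attach(2)[of ?V] u by simp
    moreover have "20 * (Q - 1) \<le> 20 * (P - 1) * (Q - 1)" using PQ by (intro mult_right_mono) auto
    ultimately show ?thesis using a bX[OF u] PQ by (simp add: algebra_simps)
  next
    case False
    then have v: "v \<in> Y" using v by auto
    then have uv: "u \<noteq> v" using u f by auto
    have "insert l ?V - {v} = insert l (?V - {v})" using v l by auto
    then have "perQ ?E (insert l ?V - {v}) = perQ E (?V - {v}) + 2 * perQ E (?V - {v} - {u})"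
      using perQ_attach(1)[of "?V - {v}"] u uv by auto
    moreover have "?V - {v} - {u} = ?V - {u, v}" by auto
    ultimately show ?thesis using bY[OF v] c[OF u v] by simp
  qed
  have 4: "5 \<le> perQ ?E (insert l ?V - {v, w})" if v: "v \<in> X" and w: "w \<in> insert l Y" for v w
  proof (cases "w = l")
    case True
    then have "insert l ?V - {v, w} = ?V - {v}" using l by auto
    with ge(2)[of "?V - {v}"] bX[OF v] PQ show ?thesis by auto
  next
    case False
    then have w: "w \<in> Y" using w by auto
    have "insert l ?V - {v, w} = insert l (?V - {v, w})" using v w l by auto
    with ge(1)[of "?V - {v, w}"] c[OF v w] show ?thesis by auto
  qed
  show ?thesis
    unfolding perQ_bounds_def V cl using 1 2 3 4 by (auto simp: P_def)
qed

end

text \<open>Leaves are removed until none is left, and by \<open>two_regular\<close> the remaining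
  graph is 2-regular. Symmetry of \<open>R\<close> under exchange of the parts reduces the leaf step
  to leaves in \<open>Y\<close>.\<close>

lemma bip_unicyclic_induct [consumes 1, case_names swap regular leaf]:
  assumes B: "bip_unicyclic X Y E"
    and swap: "\<And>X Y E. R Y X E \<Longrightarrow> R X Y E"
    and reg: "\<And>X Y E. bip_unicyclic X Y E \<Longrightarrow> card X = card Y \<Longrightarrow>
      (\<And>v. v \<in> X \<union> Y \<Longrightarrow> degree E v = 2) \<Longrightarrow> R X Y E"
    and leaf: "\<And>X Y E l u. bip_unicyclic X Y E \<Longrightarrow> l \<notin> X \<union> Y \<Longrightarrow> l \<notin> \<Union>E \<Longrightarrow> u \<in> X \<Longrightarrow>
      R X Y E \<Longrightarrow> R X (insert l Y) (insert {l, u} E)"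
  shows "R X Y E"
  using B
proof (induction "card X + card Y" arbitrary: X Y E rule: less_induct)
  case less
  \<comment> \<open>The step carries its own variables and induction hypothesis, so that it also
    applies with the parts exchanged.\<close>
  have step: "R X Y E" if B: "bip_unicyclic X Y E" and l: "l \<in> Y" "degree E l = 1"
    and IH: "\<And>X' Y' E'. card X' + card Y' < card X + card Y \<Longrightarrow> bip_unicyclic X' Y' E' \<Longrightarrow> R X' Y' E'"
    for X Y E l
  proof -
    obtain u E' where *: "u \<in> X" "E = insert {l, u} E'" "l \<notin> \<Union>E'" "bip_unicyclic X (Y - {l}) E'"
      by (rule remove_leaf[OF B l])
    have Y: "Y = insert l (Y - {l})" using l by auto
    have "card (Y - {l}) < card Y" using l bip_finite[OF B] by (intro psubset_card_mono) auto
    then have "R X (Y - {l}) E'" using * by (intro IH) auto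
    moreover have "l \<notin> X \<union> (Y - {l})" using l bip_finite[OF B] by auto
    ultimately have "R X (insert l (Y - {l})) (insert {l, u} E')" using * by (intro leaf) auto
    with Y * show ?thesis by simp
  qed
  show ?case
  proof (cases "\<exists>v\<in>X \<union> Y. degree E v = 1")
    case True
    then show ?thesis
    proof (elim bexE UnE)
      fix l assume "l \<in> Y" "degree E l = 1"
      then show ?thesis using step[OF less.prems _ _ less.hyps] by blast
    next
      fix l assume l: "l \<in> X" "degree E l = 1"
      have "R X' Y' E'" if "card X' + card Y' < card Y + card X" "bip_unicyclic X' Y' E'" for X' Y' E'
        using less.hyps[of X' Y' E'] that by simp
      then show ?thesis using swap step[OF bip_unicyclic_swap[OF less.prems] l] by blast
    qed
  next
    case False
    have "card X = card Y" "\<And>v. v \<in> X \<union> Y \<Longrightarrow> degree E v = 2"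
      using two_regular[OF less.prems _ bip_degree_sum[OF bip_unicyclic_swap[OF less.prems]]] False by auto
    with less.prems show ?thesis by (intro reg) auto
  qed
qed

lemma perQ_bounds:
  assumes "bip_unicyclic X Y E" shows "perQ_bounds X Y E"
  using assms
proof (induction rule: bip_unicyclic_induct)
  case (swap X Y E)
  then show ?case by (rule perQ_bounds_swap)
next
  case (regular X Y E)
  then show ?case by (intro perQ_bounds_regular)
next
  case (leaf X Y E l u)
  then show ?case by (intro perQ_bounds_attach)
qed

subsection \<open>Equality\<close>

text \<open>For \<open>Y = {y1, y2}\<close> the vertices \<open>x1\<close> and \<open>x2\<close> are interchangeable, hence the exceptional case.\<close>
lemma double_star_plus_centre:
  assumes B: "bip_unicyclic X Y (double_star_plus x1 x2 y1 y2 X Y)"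
    and xy: "x1 \<in> X" "x2 \<in> X" "x1 \<noteq> x2" "y1 \<in> Y" "y2 \<in> Y" "y1 \<noteq> y2"
    and u: "u \<in> X" "u \<noteq> x1"
    and le: "perQ (double_star_plus x1 x2 y1 y2 X Y) (X \<union> Y - {u}) \<le> 10 * (int (card X) - 1) + 2"
  shows "u = x2 \<and> Y = {y1, y2}"
proof (rule ccontr)
  let ?E = "double_star_plus x1 x2 y1 y2 X Y"
  assume contra: "\<not> ?thesis"
  note f = bip_finite[OF B]
  show False
  proof (cases "u = x2")
    case True
    \<comment> \<open>A third vertex \<open>y3\<close> of \<open>Y\<close> is a leaf at
      \<open>x1\<close>. Without it the bound for the deletion of \<open>x2\<close> is the same, and
      attaching it adds at least 2.\<close>
    with contra xy obtain y3 where y3: "y3 \<in> Y" "y3 \<noteq> y1" "y3 \<noteq> y2" by auto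
    have "{e \<in> ?E. y3 \<in> e} = {{y3, x1}}"
      using y3 xy f by (auto simp: double_star_plus_def)
    then have "degree ?E y3 = 1" by (simp add: degree_def)
    then obtain w E' where *: "w \<in> X" "?E = insert {y3, w} E'" "y3 \<notin> \<Union>E'" "bip_unicyclic X (Y - {y3}) E'"
      using remove_leaf[OF B y3(1)] by metis
    have "{y3, w} \<in> ?E" using * by auto
    then have w: "w = x1" using y3 xy f * by (auto simp: double_star_plus_def doubleton_eq_iff)
    have y3n: "y3 \<notin> X \<union> (Y - {y3})" "y3 \<noteq> x2" using y3 f xy by auto
    let ?S = "X \<union> (Y - {y3}) - {x2}"
    have S: "X \<union> Y - {u} = insert y3 ?S" using True y3 y3n by auto
    have x1S: "x1 \<in> ?S" using xy by auto
    have "perQ ?E (X \<union> Y - {u}) = perQ E' ?S + 2 * perQ E' (?S - {x1})"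
      unfolding S *(2) using perQ_attach(1)[OF *(4) y3n(1) *(3) *(1), of ?S] w x1S by auto
    moreover have "1 \<le> perQ E' (?S - {x1})" by (rule perQ_pos[OF *(4)]) auto
    moreover have "10 * (int (card X) - 1) + 2 \<le> perQ E' ?S"
      using perQ_bounds[OF *(4)] xy by (simp add: perQ_bounds_def)
    ultimately show False using le by linarith
  next
    case False
    \<comment> \<open>Here \<open>u\<close> is a leaf at \<open>y1\<close>. Deleting it leaves two
      permanents of the graph without \<open>u\<close>, whose bounds together exceed
      \<open>10 P + 2\<close>, where \<open>P + 1 = card X\<close>.\<close>
    have "{e \<in> ?E. u \<in> e} = {{u, y1}}"
      using u False xy f by (auto simp: double_star_plus_def)
    then have deg: "degree ?E u = 1" by (simp add: degree_def)
    obtain w E' where *: "w \<in> Y" "?E = insert {u, w} E'" "u \<notin> \<Union>E'" "bip_unicyclic Y (X - {u}) E'"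
      using remove_leaf[OF bip_unicyclic_swap[OF B] u(1) deg] by metis
    have un: "u \<notin> Y \<union> (X - {u})" using u f by auto
    define P Q where "P = int (card (X - {u}))" and "Q = int (card Y)"
    have PQ: "2 \<le> P" "2 \<le> Q" using bip_cards[OF *(4)] by (auto simp: P_def Q_def)
    have cX: "int (card X) = P + 1" using u f card_gt_0_iff[of X] by (auto simp: P_def)
    have S: "X \<union> Y - {u} = Y \<union> (X - {u})" using un by auto
    have "perQ ?E (X \<union> Y - {u}) = perQ E' (Y \<union> (X - {u})) + perQ E' (Y \<union> (X - {u}) - {w})"
      unfolding S *(2) using perQ_attach(2)[OF *(4) un *(3) *(1), of "Y \<union> (X - {u})"] *(1) by auto
    moreover have "20 * (Q - 1) * (P - 1) + 4 * (Q + P) \<le> perQ E' (Y \<union> (X - {u}))"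
      "10 * (Q - 1) + 2 \<le> perQ E' (Y \<union> (X - {u}) - {w})"
      using perQ_bounds[OF *(4)] *(1) by (auto simp: perQ_bounds_def P_def Q_def)
    moreover have "20 * (P - 1) \<le> 20 * (Q - 1) * (P - 1)" using PQ by (intro mult_right_mono) auto
    ultimately show False using le cX PQ by (simp add: algebra_simps)
  qed
qed

text \<open>Given \<open>perQ_bounds\<close>, the assumed \<open>\<le>\<close> forces both terms of
  the leaf recursion down to their bounds, so the smaller graph is extremal too and \<open>u\<close>
  can be taken as a centre.\<close>

lemma perQ_equality:
  assumes "bip_unicyclic X Y E"
    and "perQ E (X \<union> Y) \<le> 20 * (int (card X) - 1) * (int (card Y) - 1) + 4 * (int (card X) + int (card Y))"
  shows "double_star_plus_graph X Y E"
  using assms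
proof (induction rule: bip_unicyclic_induct)
  case (swap X Y E)
  from swap.prems have "perQ E (Y \<union> X) \<le> 20 * (int (card Y) - 1) * (int (card X) - 1) + 4 * (int (card Y) + int (card X))"
    by (simp add: Un_commute algebra_simps)
  then show ?case by (rule double_star_plus_graph_swap[OF swap.IH])
next
  case (regular X Y E)
  \<comment> \<open>Longer cycles exceed the bound strictly, so only the 4-cycle remains.\<close>
  then have c: "card X = 2" "card Y = 2" using perQ_bounds_regular(2)[of X Y E] by force+
  obtain x y where xy: "x \<in> X" "y \<in> Y" using bip_finite[OF regular.hyps(1)] by auto
  obtain x2 y2 where "x2 \<in> X" "x \<noteq> x2" "y2 \<in> Y" "y \<noteq> y2" "E = double_star_plus x x2 y y2 X Y"
    by (rule bip_unicyclic_K22[OF regular.hyps(1) c xy])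
  with xy show ?case unfolding double_star_plus_graph_def by blast
next
  case (leaf X Y E l u)
  let ?V = "X \<union> Y"
  note B = leaf.hyps(1)
  note f = bip_finite[OF B]
  have cl: "int (card (insert l Y)) = int (card Y) + 1" using f leaf.hyps by simp
  have "perQ (insert {l, u} E) (X \<union> insert l Y) = perQ E ?V + 2 * perQ E (?V - {u})"
    using perQ_attach(1)[OF leaf.hyps, of ?V] leaf.hyps by simp
  moreover have "10 * (int (card X) - 1) + 2 \<le> perQ E (?V - {u})"
    "20 * (int (card X) - 1) * (int (card Y) - 1) + 4 * (int (card X) + int (card Y)) \<le> perQ E ?V"
    using perQ_bounds[OF B] leaf.hyps by (auto simp: perQ_bounds_def)
  ultimately have V: "perQ E ?V \<le> 20 * (int (card X) - 1) * (int (card Y) - 1) + 4 * (int (card X) + int (card Y))"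
    and U: "perQ E (?V - {u}) \<le> 10 * (int (card X) - 1) + 2"
    using leaf.prems unfolding cl by (auto simp: algebra_simps)
  obtain x1 x2 y1 y2 where xy: "x1 \<in> X" "x2 \<in> X" "x1 \<noteq> x2" "y1 \<in> Y" "y2 \<in> Y" "y1 \<noteq> y2"
    and E: "E = double_star_plus x1 x2 y1 y2 X Y"
    using leaf.IH[OF V] unfolding double_star_plus_graph_def by blast
  have "\<exists>x2\<in>X. u \<noteq> x2 \<and> E = double_star_plus u x2 y1 y2 X Y"
  proof (cases "u = x1")
    case True
    with xy E show ?thesis by auto
  next
    case False
    have "u = x2 \<and> Y = {y1, y2}"
      by (rule double_star_plus_centre[OF _ xy leaf.hyps(4) False]) (use B U E in auto)
    \<comment> \<open>Both \<open>x1\<close> and \<open>x2\<close> have exactly the neighbours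
      \<open>y1\<close> and \<open>y2\<close> here, so their names may be exchanged.\<close>
    then have "E = double_star_plus u x1 y1 y2 X Y"
      using xy unfolding E by (auto simp: double_star_plus_def)
    with xy False show ?thesis by blast
  qed
  then obtain x3 where "x3 \<in> X" "u \<noteq> x3" "E = double_star_plus u x3 y1 y2 X Y" by blast
  moreover have "insert {l, u} (double_star_plus u x3 y1 y2 X Y) = double_star_plus u x3 y1 y2 X (insert l Y)"
    by (auto simp: double_star_plus_def insert_commute)
  ultimately show ?case
    using xy leaf.hyps unfolding double_star_plus_graph_def by blast
qed

subsection \<open>Isomorphism with the extremal graph\<close>

text \<open>If no edge crossed \<open>S\<close>, every walk starting in \<open>S\<close> would stay
  in it, against connectivity.\<close>

lemma unicyclic_bip_unicyclic:
  assumes U: "unicyclic V E" and XY: "X \<union> Y = V" "X \<inter> Y = {}" "X \<noteq> {}" "Y \<noteq> {}"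
    and ed: "\<forall>e\<in>E. \<exists>x\<in>X. \<exists>y\<in>Y. e = {x, y}"
  shows "bip_unicyclic X Y E"
proof -
  have fin: "finite V" and con: "\<And>u v. u \<in> V \<Longrightarrow> v \<in> V \<Longrightarrow> (adjacent E)\<^sup>*\<^sup>* u v" and c: "card E = card V"
    using U by (auto simp: unicyclic_def simple_graph_def connected_graph_def)
  then have f: "finite X" "finite Y" using XY by auto
  have cut: "\<exists>e\<in>E. e \<inter> S \<noteq> {} \<and> e - S \<noteq> {}" if S: "S \<noteq> {}" "S \<subset> X \<union> Y" for S
  proof (rule ccontr)
    assume no: "\<not> ?thesis"
    obtain s t where st: "s \<in> S" "t \<in> V" "t \<notin> S" using S XY by auto
    have "(adjacent E)\<^sup>*\<^sup>* s t" using con st S XY by auto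
    then have "t \<in> S"
    proof induction
      case (step y z)
      then have "{y, z} \<in> E" by (simp add: adjacent_def)
      with no step show ?case by auto
    qed (rule st)
    with st show False by simp
  qed
  moreover have "\<forall>S. S \<noteq> {} \<and> S \<subset> X \<union> Y \<longrightarrow> (\<exists>e\<in>E. e \<inter> S \<noteq> {} \<and> e - S \<noteq> {})"
    by (intro allI impI, elim conjE, rule cut)
  moreover have "card E = card X + card Y" unfolding c XY(1)[symmetric] by (rule card_Un_disjoint[OF f XY(2)])
  ultimately show ?thesis
    unfolding bip_unicyclic_def by (intro conjI f XY(2-4) ed)
qed

text \<open>Edges are subsets of \<open>V\<close>, where \<open>f\<close> is injective, so an edge
  is determined by its image.\<close>

lemma graph_iso_image:
  assumes f: "bij_betw f V V'" and sub: "\<Union>E \<subseteq> V" and E': "E' = (`) f ` E"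
  shows "graph_iso V E V' E'"
  unfolding graph_iso_def
proof (intro exI[of _ f] conjI ballI)
  show "bij_betw f V V'" by (rule f)
  fix u v assume uv: "u \<in> V" "v \<in> V"
  have inj: "inj_on f V" using f by (rule bij_betw_imp_inj_on)
  have "{f u, f v} \<in> E' \<longleftrightarrow> (\<exists>e\<in>E. f ` {u, v} = f ` e)" by (auto simp: E')
  also have "\<dots> \<longleftrightarrow> (\<exists>e\<in>E. {u, v} = e)"
  proof (rule bex_cong[OF refl])
    fix e assume "e \<in> E"
    with uv sub show "f ` {u, v} = f ` e \<longleftrightarrow> {u, v} = e"
      by (intro inj_on_image_eq_iff[OF inj]) auto
  qed
  finally show "{u, v} \<in> E \<longleftrightarrow> {f u, f v} \<in> E'" by auto
qed

lemma double_star_plus_image: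
  "(`) f ` double_star_plus x1 x2 y1 y2 X Y = double_star_plus (f x1) (f x2) (f y1) (f y2) (f ` X) (f ` Y)"
  by (simp add: double_star_plus_def image_Un image_image)

lemma double_star_plus_subset:
  assumes "x1 \<in> X" "x2 \<in> X" "y1 \<in> Y" "y2 \<in> Y"
  shows "\<Union>(double_star_plus x1 x2 y1 y2 X Y) \<subseteq> X \<union> Y"
  using assms by (auto simp: double_star_plus_def)

text \<open>This matches the distinguished vertices of two double stars; the remaining vertices of a
  part may be matched arbitrarily.\<close>

lemma bij_betw_two_points:
  assumes "finite A" "finite B" "card A = card B" "a1 \<in> A" "a2 \<in> A" "a1 \<noteq> a2" "b1 \<in> B" "b2 \<in> B" "b1 \<noteq> b2"
  obtains f where "bij_betw f A B" "f a1 = b1" "f a2 = b2"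
proof -
  have "card (A - {a1, a2}) = card (B - {b1, b2})" using assms by (simp add: card_Diff_subset)
  then obtain g where g: "bij_betw g (A - {a1, a2}) (B - {b1, b2})"
    using finite_same_card_bij[of "A - {a1, a2}" "B - {b1, b2}"] assms by auto
  define f where "f = g(a1 := b1, a2 := b2)"
  have "bij_betw f (A - {a1, a2}) (B - {b1, b2})"
    using g by (subst bij_betw_cong[of _ _ g]) (auto simp: f_def)
  moreover have "bij_betw f {a1, a2} {b1, b2}" using assms by (auto simp: bij_betw_def f_def)
  ultimately have "bij_betw f (A - {a1, a2} \<union> {a1, a2}) (B - {b1, b2} \<union> {b1, b2})"
    by (rule bij_betw_combine) auto
  moreover have "A - {a1, a2} \<union> {a1, a2} = A" "B - {b1, b2} \<union> {b1, b2} = B" using assms by auto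
  ultimately show ?thesis using assms by (intro that[of f]) (auto simp: f_def)
qed

lemma double_star_plus_graph_iso:
  assumes E: "double_star_plus_graph X Y E" and E': "double_star_plus_graph X' Y' E'"
    and fin: "finite X" "finite Y" "finite X'" "finite Y'" and c: "card X = card X'" "card Y = card Y'"
    and XY: "X \<inter> Y = {}" "X' \<inter> Y' = {}"
  shows "graph_iso (X \<union> Y) E (X' \<union> Y') E'"
proof -
  obtain x1 x2 y1 y2 where xy: "x1 \<in> X" "x2 \<in> X" "x1 \<noteq> x2" "y1 \<in> Y" "y2 \<in> Y" "y1 \<noteq> y2"
    and E: "E = double_star_plus x1 x2 y1 y2 X Y"
    using E unfolding double_star_plus_graph_def by blast
  obtain x1' x2' y1' y2' where xy': "x1' \<in> X'" "x2' \<in> X'" "x1' \<noteq> x2'" "y1' \<in> Y'" "y2' \<in> Y'" "y1' \<noteq> y2'"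
    and E': "E' = double_star_plus x1' x2' y1' y2' X' Y'"
    using E' unfolding double_star_plus_graph_def by blast
  obtain g where g: "bij_betw g X X'" "g x1 = x1'" "g x2 = x2'"
    using bij_betw_two_points[OF fin(1,3) c(1) xy(1-3) xy'(1-3)] by metis
  obtain h where h: "bij_betw h Y Y'" "h y1 = y1'" "h y2 = y2'"
    using bij_betw_two_points[OF fin(2,4) c(2) xy(4-6) xy'(4-6)] by metis
  define f where "f v = (if v \<in> X then g v else h v)" for v
  have fX: "bij_betw f X X'" using g(1) by (subst bij_betw_cong[of _ _ g]) (auto simp: f_def)
  have fY: "bij_betw f Y Y'" using h(1) XY by (subst bij_betw_cong[of _ _ h]) (auto simp: f_def)
  have "f x1 = x1'" "f x2 = x2'" "f y1 = y1'" "f y2 = y2'"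
    using g h xy XY by (auto simp: f_def)
  moreover have "f ` X = X'" "f ` Y = Y'" using fX fY by (auto simp: bij_betw_def)
  ultimately have "E' = (`) f ` E" unfolding E E' double_star_plus_image by simp
  then show ?thesis
    using bij_betw_combine[OF fX fY XY(2)] double_star_plus_subset[OF xy(1,2,4,5)] E
    by (intro graph_iso_image) simp_all
qed

text \<open>The parts are pulled back along the inverse of the isomorphism. Simplicity turns every
  edge into a pair of vertices of \<open>V\<close>, the only sets that \<open>graph_iso\<close>
  speaks about.\<close>

lemma graph_iso_double_star_plus:
  assumes iso: "graph_iso V E (X' \<union> Y') E'" and simple: "simple_graph V E"
    and D: "double_star_plus_graph X' Y' E'" and XY': "X' \<inter> Y' = {}"
  obtains X Y where "X \<union> Y = V" "X \<inter> Y = {}" "card X = card X'" "card Y = card Y'"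
    "double_star_plus_graph X Y E"
proof -
  obtain f where f: "bij_betw f V (X' \<union> Y')"
    and fE: "\<And>u v. u \<in> V \<Longrightarrow> v \<in> V \<Longrightarrow> {u, v} \<in> E \<longleftrightarrow> {f u, f v} \<in> E'"
    using iso by (auto simp: graph_iso_def)
  define g where "g = inv_into V f"
  have g: "bij_betw g (X' \<union> Y') V" using f unfolding g_def by (rule bij_betw_inv_into)
  have gf: "g (f v) = v" if "v \<in> V" for v using f that by (simp add: g_def bij_betw_inv_into_left)
  have fg: "f (g v) = v" if "v \<in> X' \<union> Y'" for v using f that by (simp add: g_def bij_betw_inv_into_right)
  obtain x1 x2 y1 y2 where xy: "x1 \<in> X'" "x2 \<in> X'" "x1 \<noteq> x2" "y1 \<in> Y'" "y2 \<in> Y'" "y1 \<noteq> y2"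
    and E': "E' = double_star_plus x1 x2 y1 y2 X' Y'"
    using D unfolding double_star_plus_graph_def by blast
  have inj: "inj_on g (X' \<union> Y')" using g by (rule bij_betw_imp_inj_on)
  have pair: "\<exists>a b. e = {a, b} \<and> a \<in> X' \<union> Y' \<and> b \<in> X' \<union> Y'" if "e \<in> E'" for e
    using that xy by (auto simp: E' double_star_plus_def)
  have "E = (`) g ` E'"
  proof (intro equalityI subsetI)
    fix e assume e: "e \<in> E"
    then obtain u v where uv: "e = {u, v}" "u \<in> V" "v \<in> V" using simple by (auto simp: simple_graph_def)
    then have "{f u, f v} \<in> E'" "e = g ` {f u, f v}" using fE e gf by auto
    then show "e \<in> (`) g ` E'" by blast
  next
    fix e assume "e \<in> (`) g ` E'"
    then obtain e' where e': "e' \<in> E'" "e = g ` e'" by auto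
    then obtain a b where ab: "e' = {a, b}" "a \<in> X' \<union> Y'" "b \<in> X' \<union> Y'" using pair by metis
    then have "g a \<in> V" "g b \<in> V" using g by (auto simp: bij_betw_def)
    then have "{g a, g b} \<in> E \<longleftrightarrow> {a, b} \<in> E'" using fE fg ab by auto
    with e' ab show "e \<in> E" by auto
  qed
  also have "\<dots> = double_star_plus (g x1) (g x2) (g y1) (g y2) (g ` X') (g ` Y')"
    by (simp add: E' double_star_plus_image)
  finally have E: "E = double_star_plus (g x1) (g x2) (g y1) (g y2) (g ` X') (g ` Y')" .
  have "g x1 \<noteq> g x2" "g y1 \<noteq> g y2" using xy by (simp_all add: inj_on_eq_iff[OF inj])
  with E xy have "double_star_plus_graph (g ` X') (g ` Y') E"
    unfolding double_star_plus_graph_def by blast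
  moreover have "g ` X' \<inter> g ` Y' = {}"
    using inj_on_image_Int[OF inj, of X' Y'] XY' by auto
  moreover have "g ` X' \<union> g ` Y' = V" using g by (auto simp: bij_betw_def image_Un)
  moreover have "card (g ` X') = card X'" "card (g ` Y') = card Y'"
    using inj by (auto intro!: card_image intro: inj_on_subset)
  ultimately show ?thesis by (intro that)
qed

lemma B_graph_double_star_plus:
  assumes "2 \<le> p" "2 \<le> q"
  obtains X Y where "X \<union> Y = B_verts p q" "X \<inter> Y = {}" "card X = p" "card Y = q" "finite X" "finite Y"
    "double_star_plus_graph X Y (B_edges p q)"
proof -
  \<comment> \<open>The pendants at \<open>0\<close> lie opposite to it, in the part of
    \<open>1\<close> and \<open>3\<close>, which gives this part \<open>2 + (p - 2)\<close>
    vertices; likewise for \<open>Y\<close>.\<close>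
  define X Y where "X = {1, 3} \<union> {4..<p + 2}" and "Y = {0, 2} \<union> {p + 2..<p + q}"
  have B: "B_edges p q = double_star_plus 1 3 0 2 X Y"
  proof -
    have "{{0, k} |k. 4 \<le> k \<and> k < p + 2} = (\<lambda>x. {x, 0}) ` {4..<p + 2}"
      "{{1, k} |k. p + 2 \<le> k \<and> k < p + q} = (\<lambda>y. {1, y}) ` {p + 2..<p + q}"
      by (auto simp: insert_commute)
    moreover have c: "{1, 0} = {0, 1 :: nat}" "{3, 2} = {2, 3 :: nat}" by auto
    ultimately show ?thesis
      unfolding B_edges_def double_star_plus_def X_def Y_def image_Un image_insert image_empty
      by (intro set_eqI) (simp only: Un_iff insert_iff empty_iff c, argo)
  qed
  have "1 \<in> X" "3 \<in> X" "(1 :: nat) \<noteq> 3" "0 \<in> Y" "2 \<in> Y" "(0 :: nat) \<noteq> 2"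
    by (auto simp: X_def Y_def)
  with B have "double_star_plus_graph X Y (B_edges p q)"
    unfolding double_star_plus_graph_def by meson
  moreover have "X \<union> Y = B_verts p q" "X \<inter> Y = {}"
    using assms by (auto simp: X_def Y_def B_verts_def)
  moreover have "card X = p" "card Y = q" "finite X" "finite Y"
    using assms by (auto simp: X_def Y_def card_insert_if)
  ultimately show ?thesis by (intro that)
qed

theorem theorem3p7:
  fixes V :: "'a set" and E :: "'a set set" and p q :: nat
  assumes "0 < p" and "p \<le> q"
    and "unicyclic V E" and "has_bipartition V E p q"
  shows "per (laplacian E) V \<ge> 20 * (int p - 1) * (int q - 1) + 4 * int (p + q)
    \<and> (per (laplacian E) V = 20 * (int p - 1) * (int q - 1) + 4 * int (p + q)
           \<longleftrightarrow> graph_iso V E (B_verts p q) (B_edges p q))"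
proof -
  obtain X Y where XY: "X \<union> Y = V" "X \<inter> Y = {}" and c: "card X = p" "card Y = q"
    and ed: "\<forall>e\<in>E. \<exists>x\<in>X. \<exists>y\<in>Y. e = {x, y}"
    using assms(4) by (auto simp: has_bipartition_def)
  have ne: "X \<noteq> {}" "Y \<noteq> {}" using c assms by auto
  have B: "bip_unicyclic X Y E" by (rule unicyclic_bip_unicyclic[OF assms(3) XY ne ed])
  note f = bip_finite[OF B]
  \<comment> \<open>One-vertex parts cannot occur, so the numbers \<open>p - 2\<close> and
    \<open>q - 2\<close> of pendants of \<open>B(p, q)\<close> make sense.\<close>
  have pq: "2 \<le> p" "2 \<le> q" using bip_cards[OF B] c by auto
  have simple: "simple_graph V E" using assms(3) by (simp add: unicyclic_def)
  have per: "per (laplacian E) V = perQ E V"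
    using f XY by (intro per_laplacian_bipartite[OF _ XY(2) ed]) auto
  have lower: "20 * (int p - 1) * (int q - 1) + 4 * int (p + q) \<le> perQ E V"
    using perQ_bounds[OF B] XY c by (simp add: perQ_bounds_def)
  obtain X' Y' where B': "X' \<union> Y' = B_verts p q" "X' \<inter> Y' = {}" "card X' = p" "card Y' = q" "finite X'" "finite Y'"
    "double_star_plus_graph X' Y' (B_edges p q)"
    by (rule B_graph_double_star_plus[OF pq])
  have "graph_iso V E (B_verts p q) (B_edges p q)"
    if "perQ E V = 20 * (int p - 1) * (int q - 1) + 4 * int (p + q)"
  proof -
    have "double_star_plus_graph X Y E"
      by (rule perQ_equality[OF B]) (use that XY c in simp)
    from double_star_plus_graph_iso[OF this B'(7)] show ?thesis using f B' c XY by simp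
  qed
  moreover have "perQ E V = 20 * (int p - 1) * (int q - 1) + 4 * int (p + q)"
    if iso: "graph_iso V E (B_verts p q) (B_edges p q)"
  proof -
    \<comment> \<open>The parts found here need not be \<open>X\<close> and \<open>Y\<close>; only
      their sizes enter the value.\<close>
    obtain X1 Y1 where "X1 \<union> Y1 = V" "X1 \<inter> Y1 = {}" "card X1 = p" "card Y1 = q" "double_star_plus_graph X1 Y1 E"
      by (rule graph_iso_double_star_plus[OF _ simple B'(7,2)]) (use iso B' in auto)
    \<comment> \<open>An infinite set has \<open>card\<close> 0, whereas \<open>p\<close> and
      \<open>q\<close> are at least 2.\<close>
    moreover from this pq have "finite X1" "finite Y1" using card.infinite by fastforce+
    ultimately show ?thesis
      using extremal_values_double_star_plus[of X1 Y1]
      unfolding double_star_plus_graph_def extremal_values_def by auto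
  qed
  ultimately show ?thesis using per lower by auto
qed

end
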